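(* Let $A\in\mathbb{R}^{d\times d}$ be symmetric, let $b\in\mathbb{R}^d$ be nonzero, let $g$ be the grade of $b$ with respect to $A$, and run MINRES on $(A,b)$ with $x_0=0$. Let $1\le \ell\le g$. If $T_\ell\not\succ 0$, then the NPC condition $c_{k-1}\gamma_k^{(1)}\ge 0$ holds for some $1\le k\le \ell$. In particular, if $k\le g$ is the first iteration for which $T_k\not\succ 0$, then the NPC condition $c_{k-1}\gamma_k^{(1)}\ge 0$ holds for this $k$.
   Context: Notation: $\|\cdot\|$ is the Euclidean norm; $M\succ 0$ means the symmetric matrix $M$ is positive definite. The Krylov subspace is $\mathcal{K}_k(A,b)=\mathrm{Span}\{b,Ab,\dots,A^{k-1}b\}$. The grade of $b$ with respect to $A$ is the positive integer $g$ such that $\dim\mathcal{K}_k(A,b)=k$ for $k\le g$ and $=g$ for $k>g$. MINRES (exact arithmetic). Initialize $\beta_1=\|b\|$, $r_0=b$, $v_1=b/\beta_1$, $v_0=x_0=\mathbf{d}_0=\mathbf{d}_{-1}=0$, $c_0=-1$, $s_0=0$, $\phi_0=\tau_0=\beta_1$, $\delta_1^{(1)}=0$. For $k=1,2,\dots,g$: set $\alpha_k=v_k^TAv_k$, $p_k=Av_k-\beta_kv_{k-1}-\alpha_kv_k$, $\beta_{k+1}=\|p_k\|$; $\delta_k^{(2)}=c_{k-1}\delta_k^{(1)}+s_{k-1}\alpha_k$, $\gamma_k^{(1)}=s_{k-1}\delta_k^{(1)}-c_{k-1}\alpha_k$, $\epsilon_{k+1}=s_{k-1}\beta_{k+1}$,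 $\delta_{k+1}^{(1)}=-c_{k-1}\beta_{k+1}$, $\gamma_k^{(2)}=\sqrt{(\gamma_k^{(1)})^2+\beta_{k+1}^2}$. If $\gamma_k^{(2)}\ne0$: $c_k=\gamma_k^{(1)}/\gamma_k^{(2)}$, $s_k=\beta_{k+1}/\gamma_k^{(2)}$, $\tau_k=c_k\phi_{k-1}$, $\phi_k=s_k\phi_{k-1}$, $\mathbf{d}_k=(v_k-\delta_k^{(2)}\mathbf{d}_{k-1}-\epsilon_k\mathbf{d}_{k-2})/\gamma_k^{(2)}$, $x_k=x_{k-1}+\tau_k\mathbf{d}_k$, and, if $\beta_{k+1}\ne0$, $v_{k+1}=p_k/\beta_{k+1}$, $r_k=s_k^2r_{k-1}-\phi_kc_kv_{k+1}$, while if $\beta_{k+1}=0$, $r_k=0$ and the iteration stops. If $\gamma_k^{(2)}=0$: $c_k=0$, $s_k=1$, $\tau_k=0$, $\phi_k=\phi_{k-1}$, $r_k=r_{k-1}$, $x_k=x_{k-1}$ and the iteration stops. (The iterations are not stopped when the NPC condition below holds. The process stops after exactly $g$ iterations, $\beta_{k+1}>0$ for $k<g$, $\beta_{g+1}=0$; $x_k$ minimizes $\|b-Ax\|$ over $\mathcal{K}_k(A,b)$ and $r_k=b-Ax_k$.) $T_k\in\mathbb{R}^{k\times k}$ is the symmetric tridiagonal matrix with diagonal $\alpha_1,\dots,\alpha_k$ and off-diagonals $\beta_2,\dots,\beta_k$; equivalently $T_k=V_k^TAV_k$ with $V_k=[v_1\,\cdots\,v_k]$ having orthonormal columns. NPC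 condition at iteration $k$: $c_{k-1}\gamma_k^{(1)}\ge0$. *)

theory Defs
  imports "HOL-Analysis.Analysis"
begin

definition krylov :: "real^'n^'n \<Rightarrow> real^'n \<Rightarrow> nat \<Rightarrow> (real^'n) set" where
  "krylov A b k = span ((\<lambda>j. ((\<lambda>x. A *v x) ^^ j) b) ` {..<k})"

definition is_grade :: "real^'n^'n \<Rightarrow> real^'n \<Rightarrow> nat \<Rightarrow> bool" where
  "is_grade A b g \<longleftrightarrow>
     0 < g \<and> (\<forall>k\<le>g. dim (krylov A b k) = k) \<and> (\<forall>k>g. dim (krylov A b k) = g)"

text \<open>
  A MINRES state after \<open>k\<close> iterations. The fields \<open>st_v\<close>, \<open>st_beta\<close>, \<open>st_delta1\<close> and
  \<open>st_eps\<close> hold the quantities that the \<open>k\<close>-th iteration computes for the next one, i.e.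
  \<open>v\<^sub>k\<^sub>+\<^sub>1\<close>, \<open>\<beta>\<^sub>k\<^sub>+\<^sub>1\<close>, \<open>\<delta>\<^sub>k\<^sub>+\<^sub>1\<^sup>(\<^sup>1\<^sup>)\<close> and \<open>\<epsilon>\<^sub>k\<^sub>+\<^sub>1\<close>; the fields \<open>st_v_prev\<close> and \<open>st_d_prev\<close> hold \<open>v\<^sub>k\<close> and
  \<open>d\<^sub>k\<^sub>-\<^sub>1\<close>; every other field has index \<open>k\<close>.
\<close>

record ('n::finite) minres_state =
  st_v_prev :: "real^'n"
  st_v      :: "real^'n"
  st_alpha  :: real
  st_beta   :: real
  st_c      :: real
  st_s      :: real
  st_phi    :: real
  st_tau    :: real
  st_delta1 :: real
  st_delta2 :: real
  st_gamma1 :: real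
  st_gamma2 :: real
  st_eps    :: real
  st_d_prev :: "real^'n"
  st_d      :: "real^'n"
  st_x      :: "real^'n"
  st_r      :: "real^'n"
  st_halted :: bool

text \<open>
  The values \<open>\<alpha>\<^sub>0\<close>, \<open>\<delta>\<^sub>0\<^sup>(\<^sup>2\<^sup>)\<close>, \<open>\<gamma>\<^sub>0\<^sup>(\<^sup>1\<^sup>)\<close> and \<open>\<gamma>\<^sub>0\<^sup>(\<^sup>2\<^sup>)\<close> are never read. \<open>\<epsilon>\<^sub>1\<close> is only ever multiplied by
  the zero vector \<open>d\<^sub>-\<^sub>1\<close>.
\<close>

definition minres_init :: "real^'n \<Rightarrow> 'n::finite minres_state" where
  "minres_init b =
    \<lparr> st_v_prev = 0, st_v = b /\<^sub>R norm b, st_alpha = 0, st_beta = norm b,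
      st_c = - 1, st_s = 0, st_phi = norm b, st_tau = norm b,
      st_delta1 = 0, st_delta2 = 0, st_gamma1 = 0, st_gamma2 = 0, st_eps = 0,
      st_d_prev = 0, st_d = 0, st_x = 0, st_r = b, st_halted = False \<rparr>"

text \<open>
  When \<open>\<beta>\<^sub>k\<^sub>+\<^sub>1 = 0\<close> there is no next Lanczos vector, and \<open>st_v\<close> and \<open>st_v_prev\<close> are left
  as they were. A halted state never changes again, so the state after \<open>k\<close> iterations carries
  index-\<open>k\<close> quantities only as long as \<open>k\<close> does not exceed the halting iteration.
\<close>

definition minres_step :: "real^'n^'n \<Rightarrow> 'n::finite minres_state \<Rightarrow> 'n minres_state" where
  "minres_step A S =
    (if st_halted S then S else
     let v      = st_v S;
         \<alpha>      = v \<bullet> (A *v v);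
         p      = A *v v - st_beta S *\<^sub>R st_v_prev S - \<alpha> *\<^sub>R v;
         \<beta>      = norm p;
         \<delta>2     = st_c S * st_delta1 S + st_s S * \<alpha>;
         \<gamma>1     = st_s S * st_delta1 S - st_c S * \<alpha>;
         \<epsilon>      = st_s S * \<beta>;
         \<delta>1     = - st_c S * \<beta>;
         \<gamma>2     = sqrt (\<gamma>1\<^sup>2 + \<beta>\<^sup>2);
         S'     = S \<lparr> st_alpha := \<alpha>, st_beta := \<beta>, st_delta1 := \<delta>1, st_delta2 := \<delta>2,
                      st_gamma1 := \<gamma>1, st_gamma2 := \<gamma>2, st_eps := \<epsilon> \<rparr>
     in if \<gamma>2 \<noteq> 0 then
          let c   = \<gamma>1 / \<gamma>2;
              s   = \<beta> / \<gamma>2;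
              \<tau>   = c * st_phi S;
              \<phi>   = s * st_phi S;
              d   = (v - \<delta>2 *\<^sub>R st_d S - st_eps S *\<^sub>R st_d_prev S) /\<^sub>R \<gamma>2;
              S'' = S' \<lparr> st_c := c, st_s := s, st_tau := \<tau>, st_phi := \<phi>,
                         st_d_prev := st_d S, st_d := d, st_x := st_x S + \<tau> *\<^sub>R d \<rparr>
          in if \<beta> \<noteq> 0 then
               let v' = p /\<^sub>R \<beta>
               in S'' \<lparr> st_v_prev := v, st_v := v',
                        st_r := s\<^sup>2 *\<^sub>R st_r S - (\<phi> * c) *\<^sub>R v' \<rparr>
             else S'' \<lparr> st_r := 0, st_halted := True \<rparr>
        else S' \<lparr> st_c := 0, st_s := 1, st_tau := 0, st_halted := True \<rparr>)"

definition minres :: "real^'n^'n \<Rightarrow> real^'n \<Rightarrow> nat \<Rightarrow> 'n::finite minres_state" where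
  "minres A b k = (minres_step A ^^ k) (minres_init b)"

definition minres_alpha :: "real^'n^'n \<Rightarrow> real^'n \<Rightarrow> nat \<Rightarrow> real" where
  "minres_alpha A b k = st_alpha (minres A b k)"

text \<open>\<open>\<beta>\<^sub>k\<close>, for \<open>k \<ge> 1\<close>, is computed in iteration \<open>k - 1\<close>.\<close>

definition minres_beta :: "real^'n^'n \<Rightarrow> real^'n \<Rightarrow> nat \<Rightarrow> real" where
  "minres_beta A b k = st_beta (minres A b (k - 1))"

definition minres_c :: "real^'n^'n \<Rightarrow> real^'n \<Rightarrow> nat \<Rightarrow> real" where
  "minres_c A b k = st_c (minres A b k)"

definition minres_gamma1 :: "real^'n^'n \<Rightarrow> real^'n \<Rightarrow> nat \<Rightarrow> real" where
  "minres_gamma1 A b k = st_gamma1 (minres A b k)"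

definition npc_condition :: "real^'n^'n \<Rightarrow> real^'n \<Rightarrow> nat \<Rightarrow> bool" where
  "npc_condition A b k \<longleftrightarrow> 0 \<le> minres_c A b (k - 1) * minres_gamma1 A b k"

text \<open>
  A \<open>k \<times> k\<close> matrix is represented by the entries with indices in \<open>{1..k}\<close> of a function
  \<open>nat \<Rightarrow> nat \<Rightarrow> real\<close>, so that the size may vary within a formula. The matrices \<open>T\<^sub>k\<close>
  are nested, and \<open>T\<^sub>k\<close> is the leading \<open>k \<times> k\<close> block of \<open>minres_T A b\<close>.
\<close>

definition minres_T :: "real^'n^'n \<Rightarrow> real^'n \<Rightarrow> nat \<Rightarrow> nat \<Rightarrow> real" where
  "minres_T A b i j =
    (if i = j then minres_alpha A b i
     else if j = Suc i then minres_beta A b j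
     else if i = Suc j then minres_beta A b i
     else 0)"

definition pos_def :: "nat \<Rightarrow> (nat \<Rightarrow> nat \<Rightarrow> real) \<Rightarrow> bool" where
  "pos_def k M \<longleftrightarrow>
     (\<forall>i\<in>{1..k}. \<forall>j\<in>{1..k}. M i j = M j i) \<and>
     (\<forall>x :: nat \<Rightarrow> real. (\<exists>i\<in>{1..k}. x i \<noteq> 0) \<longrightarrow>
        0 < (\<Sum>i\<in>{1..k}. \<Sum>j\<in>{1..k}. x i * M i j * x j))"

end

theory Submission
  imports Defs
begin

text \<open>
  Both the definiteness of \<open>T\<^sub>k\<close> and the NPC condition are read off the pivots
  \<open>u\<^sub>1 = \<alpha>\<^sub>1\<close>, \<open>u\<^sub>k\<^sub>+\<^sub>1 = \<alpha>\<^sub>k\<^sub>+\<^sub>1 - \<beta>\<^sub>k\<^sub>+\<^sub>1\<^sup>2 / u\<^sub>k\<close> of the factorization \<open>T = L D L\<^sup>T\<close>.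

  Completing squares turns the quadratic form of \<open>T\<^sub>k\<close> into a sum of squares weighted by the
  pivots, so that once \<open>u\<^sub>1, \<dots>, u\<^sub>k\<^sub>-\<^sub>1\<close> are positive, \<open>T\<^sub>k\<close> is positive definite exactly when
  \<open>u\<^sub>k > 0\<close> (\<open>pos_def_tridiag_iff_pivot_pos\<close>). On the MINRES side, the rotations that reduce \<open>T\<^sub>k\<close>
  to triangular form carry the same information: substituting \<open>c\<^sub>k = \<gamma>\<^sub>k\<^sup>(\<^sup>1\<^sup>) / \<gamma>\<^sub>k\<^sup>(\<^sup>2\<^sup>)\<close> and
  \<open>s\<^sub>k = \<beta>\<^sub>k\<^sub>+\<^sub>1 / \<gamma>\<^sub>k\<^sup>(\<^sup>2\<^sup>)\<close> into the recurrence for \<open>\<gamma>\<^sup>(\<^sup>1\<^sup>)\<close> shows that, as long as the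
  iteration runs and the earlier pivots are positive, \<open>- \<gamma>\<^sub>k\<^sup>(\<^sup>1\<^sup>) / c\<^sub>k\<^sub>-\<^sub>1\<close> satisfies the pivot
  recurrence (\<open>minres_gamma1_eq_pivot\<close>). Hence \<open>c\<^sub>k\<^sub>-\<^sub>1 \<gamma>\<^sub>k\<^sup>(\<^sup>1\<^sup>) = - c\<^sub>k\<^sub>-\<^sub>1\<^sup>2 u\<^sub>k\<close>, and at the first \<open>k\<close>
  with \<open>T\<^sub>k\<close> not positive definite, where \<open>u\<^sub>k \<le> 0\<close>, this is nonnegative. The claim about an arbitrary \<open>l\<close>
  follows by taking the least \<open>k \<le> l\<close> of this kind.

  After the iteration has halted, the NPC condition holds outright: the state no longer changes, so
  both factors of the condition belong to the same iteration, and there \<open>c\<close> is either \<open>0\<close> or a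
  positive multiple of \<open>\<gamma>\<^sup>(\<^sup>1\<^sup>)\<close> (\<open>npc_condition_if_halted\<close>).
\<close>

section \<open>Pivots and definiteness of tridiagonal matrices\<close>

definition tridiag :: "(nat \<Rightarrow> real) \<Rightarrow> (nat \<Rightarrow> real) \<Rightarrow> nat \<Rightarrow> nat \<Rightarrow> real" where
  "tridiag a b i j =
    (if i = j then a i else if j = Suc i then b j else if i = Suc j then b i else 0)"

text \<open>
  The diagonal of \<open>D\<close> in the factorization \<open>L D L\<^sup>T\<close> of a symmetric tridiagonal matrix with rows
  numbered from \<open>1\<close>. Since \<open>x / 0 = 0\<close>, the value \<open>0\<close> at index \<open>0\<close> makes the first pivot \<open>a 1\<close>.
\<close>

primrec pivot :: "(nat \<Rightarrow> real) \<Rightarrow> (nat \<Rightarrow> real) \<Rightarrow> nat \<Rightarrow> real" where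
  "pivot a b 0 = 0"
| "pivot a b (Suc k) = a (Suc k) - (b (Suc k))\<^sup>2 / pivot a b k"

lemma tridiag_sym: "tridiag a b i j = tridiag a b j i"
  by (auto simp: tridiag_def)

lemma tridiag_last_column_sum:
  assumes "1 \<le> l"
  shows "(\<Sum>i\<in>{1..l}. x i * tridiag a b i (Suc l)) = x l * b (Suc l)"
proof -
  have "(\<Sum>i\<in>{1..l}. x i * tridiag a b i (Suc l)) = (\<Sum>i\<in>{1..l}. if i = l then x l * b (Suc l) else 0)"
    by (intro sum.cong) (auto simp: tridiag_def)
  also have "\<dots> = x l * b (Suc l)"
    using assms by simp
  finally show ?thesis .
qed

text \<open>
  Each new row contributes \<open>2 \<beta> x\<^sub>l x\<^sub>l\<^sub>+\<^sub>1 + \<alpha> x\<^sub>l\<^sub>+\<^sub>1\<^sup>2\<close>, which is absorbed into the last term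
  \<open>u\<^sub>l x\<^sub>l\<^sup>2\<close> by completing the square; the coefficient left over at \<open>x\<^sub>l\<^sub>+\<^sub>1\<^sup>2\<close> is the next pivot.
\<close>

lemma tridiag_form_eq_sum_squares:
  assumes "1 \<le> l" and "\<And>j. 1 \<le> j \<Longrightarrow> j < l \<Longrightarrow> pivot a b j \<noteq> 0"
  shows "(\<Sum>i\<in>{1..l}. \<Sum>j\<in>{1..l}. x i * tridiag a b i j * x j) =
    (\<Sum>k\<in>{1..<l}. pivot a b k * (x k + b (Suc k) * x (Suc k) / pivot a b k)\<^sup>2)
      + pivot a b l * (x l)\<^sup>2"
  using assms
proof (induction l rule: nat_induct_at_least)
  case base
  show ?case by (simp add: tridiag_def power2_eq_square)
next
  case (Suc l)
  define u where "u = pivot a b l"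
  have u: "u \<noteq> 0" using Suc.prems[of l] Suc.hyps by (simp add: u_def)
  have col: "(\<Sum>i\<in>{1..l}. x i * tridiag a b i (Suc l) * x (Suc l)) = x l * b (Suc l) * x (Suc l)"
    using tridiag_last_column_sum[OF Suc.hyps, of x a b] by (simp add: sum_distrib_right[symmetric])
  have row: "(\<Sum>j\<in>{1..l}. x (Suc l) * tridiag a b (Suc l) j * x j) = x l * b (Suc l) * x (Suc l)"
    unfolding col[symmetric] by (intro sum.cong) (auto simp: tridiag_sym[of a b "Suc l"])
  have "(\<Sum>i\<in>{1..Suc l}. \<Sum>j\<in>{1..Suc l}. x i * tridiag a b i j * x j) =
      (\<Sum>i\<in>{1..l}. \<Sum>j\<in>{1..l}. x i * tridiag a b i j * x j)
        + 2 * (x l * b (Suc l) * x (Suc l)) + a (Suc l) * (x (Suc l))\<^sup>2"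
    using col row by (simp add: sum.distrib) (simp add: tridiag_def power2_eq_square)
  also have "(\<Sum>i\<in>{1..l}. \<Sum>j\<in>{1..l}. x i * tridiag a b i j * x j) =
      (\<Sum>k\<in>{1..<l}. pivot a b k * (x k + b (Suc k) * x (Suc k) / pivot a b k)\<^sup>2) + u * (x l)\<^sup>2"
    unfolding u_def by (rule Suc.IH) (use Suc.prems in auto)
  finally have "(\<Sum>i\<in>{1..Suc l}. \<Sum>j\<in>{1..Suc l}. x i * tridiag a b i j * x j) =
      (\<Sum>k\<in>{1..<l}. pivot a b k * (x k + b (Suc k) * x (Suc k) / pivot a b k)\<^sup>2)
        + (u * (x l)\<^sup>2 + 2 * (x l * b (Suc l) * x (Suc l)) + a (Suc l) * (x (Suc l))\<^sup>2)"
    by simp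
  moreover have "u * (x l)\<^sup>2 + 2 * (x l * b (Suc l) * x (Suc l)) + a (Suc l) * (x (Suc l))\<^sup>2 =
      u * (x l + b (Suc l) * x (Suc l) / u)\<^sup>2 + (a (Suc l) - (b (Suc l))\<^sup>2 / u) * (x (Suc l))\<^sup>2"
    using u by (simp add: field_simps power2_eq_square)
  ultimately show ?case
    using Suc.hyps by (simp add: u_def)
qed

text \<open>
  If the last pivot is positive too, the sum of squares vanishes only when \<open>x\<^sub>l = 0\<close> and, going
  backwards, every other \<open>x\<^sub>k\<close> vanishes. Conversely, the vector with \<open>x\<^sub>l = 1\<close> that annihilates all
  the other squares has value \<open>u\<^sub>l\<close>.
\<close>

lemma pos_def_tridiag_iff_pivot_pos:
  assumes l: "1 \<le> l" and pos: "\<And>j. 1 \<le> j \<Longrightarrow> j < l \<Longrightarrow> 0 < pivot a b j"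
  shows "pos_def l (tridiag a b) \<longleftrightarrow> 0 < pivot a b l"
proof -
  define u where "u = pivot a b"
  define Q where "Q x = (\<Sum>i\<in>{1..l}. \<Sum>j\<in>{1..l}. x i * tridiag a b i j * x j)" for x
  define q where "q x k = u k * (x k + b (Suc k) * x (Suc k) / u k)\<^sup>2" for x k
  have upos: "0 < u j" if "1 \<le> j" "j < l" for j
    using pos that by (simp add: u_def)
  have Q: "Q x = (\<Sum>k\<in>{1..<l}. q x k) + u l * (x l)\<^sup>2" for x
    unfolding Q_def q_def u_def
    by (rule tridiag_form_eq_sum_squares[OF l]) (use pos in force)
  have pd: "pos_def l (tridiag a b) \<longleftrightarrow> (\<forall>x. (\<exists>i\<in>{1..l}. x i \<noteq> 0) \<longrightarrow> 0 < Q x)"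
    unfolding pos_def_def Q_def using tridiag_sym[of a b] by blast
  show ?thesis
  proof
    assume "pos_def l (tridiag a b)"
    moreover define x where "x k = (\<Prod>j\<in>{k..<l}. - b (Suc j) / u j)" for k
    moreover have "x l = 1"
      by (simp add: x_def)
    ultimately have "0 < Q x"
      using pd l by (metis atLeastAtMost_iff order_refl zero_neq_one)
    moreover have "q x k = 0" if k: "k \<in> {1..<l}" for k
    proof -
      have "x k = - b (Suc k) / u k * x (Suc k)"
        using k by (simp add: x_def prod.atLeast_Suc_lessThan)
      then show ?thesis by (simp add: q_def)
    qed
    ultimately show "0 < pivot a b l"
      by (simp add: Q \<open>x l = 1\<close> u_def)
  next
    assume "0 < pivot a b l"
    then have ul: "0 < u l" by (simp add: u_def)
    have "0 < Q x" if nz: "\<exists>i\<in>{1..l}. x i \<noteq> 0" for x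
    proof (rule ccontr)
      have q_nonneg: "0 \<le> q x k" if "k \<in> {1..<l}" for k
        using upos[of k] that by (simp add: q_def)
      have "0 \<le> (\<Sum>k\<in>{1..<l}. q x k)" "0 \<le> u l * (x l)\<^sup>2"
        using q_nonneg ul by (auto intro: sum_nonneg)
      moreover assume "\<not> 0 < Q x"
      ultimately have "(\<Sum>k\<in>{1..<l}. q x k) = 0" and last: "u l * (x l)\<^sup>2 = 0"
        using Q[of x] by linarith+
      then have q0: "q x k = 0" if "k \<in> {1..<l}" for k
        using sum_nonneg_eq_0_iff[of "{1..<l}" "q x"] q_nonneg that by blast
      have "1 \<le> i \<longrightarrow> x i = 0" if "i \<le> l" for i
        using that
      proof (induction i rule: inc_induct)
        case base
        show ?case using last ul by simp
      next
        case (step k)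
        show ?case using q0[of k] upos[of k] step by (auto simp: q_def)
      qed
      with nz show False by auto
    qed
    then show "pos_def l (tridiag a b)" by (simp add: pd)
  qed
qed

section \<open>The scalar recurrences of MINRES\<close>

lemma minres_Suc: "minres A b (Suc k) = minres_step A (minres A b k)"
  by (simp add: minres_def)

lemma minres_step_scalars:
  fixes A :: "real^'n^'n" and S :: "'n::finite minres_state"
  assumes "\<not> st_halted S"
  defines "S' \<equiv> minres_step A S"
  shows "st_gamma1 S' = st_s S * st_delta1 S - st_c S * st_alpha S'"
    and "st_delta1 S' = - st_c S * st_beta S'"
    and "st_gamma2 S' = sqrt ((st_gamma1 S')\<^sup>2 + (st_beta S')\<^sup>2)"
    and "st_gamma2 S' \<noteq> 0 \<Longrightarrow> st_c S' = st_gamma1 S' / st_gamma2 S'"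
    and "st_gamma2 S' \<noteq> 0 \<Longrightarrow> st_s S' = st_beta S' / st_gamma2 S'"
    and "st_gamma2 S' = 0 \<Longrightarrow> st_c S' = 0"
  using assms(1) unfolding S'_def
  by (auto simp: minres_step_def Let_def split: if_splits
      simp del: real_sqrt_eq_0_iff sum_power2_eq_zero_iff norm_eq_zero)

lemma minres_halted_mono:
  assumes "st_halted (minres A b k)" "k \<le> m"
  shows "minres A b m = minres A b k"
  using assms(2)
proof (induction m rule: dec_induct)
  case (step m)
  then show ?case using assms(1) by (simp add: minres_Suc minres_step_def)
qed simp

lemma minres_c_gamma1_nonneg_if_halted:
  "st_halted (minres A b k) \<Longrightarrow> 0 \<le> st_c (minres A b k) * st_gamma1 (minres A b k)"
proof (induction k)
  case 0
  then show ?case by (simp add: minres_def minres_init_def)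
next
  case (Suc k)
  show ?case
  proof (cases "st_halted (minres A b k)")
    case True
    then show ?thesis using Suc.IH minres_halted_mono[OF True, of "Suc k"] by simp
  next
    case False
    let ?S = "minres A b (Suc k)"
    note sc = minres_step_scalars[OF False, of A, folded minres_Suc]
    show ?thesis
    proof (cases "st_gamma2 ?S = 0")
      case False
      have "0 \<le> st_gamma2 ?S" by (simp add: sc(3))
      then show ?thesis by (simp add: sc(4)[OF False])
    qed (simp add: sc(6))
  qed
qed

lemma npc_condition_if_halted:
  assumes "st_halted (minres A b k)"
  shows "npc_condition A b (Suc k)"
  using minres_c_gamma1_nonneg_if_halted[OF assms] minres_halted_mono[OF assms, of "Suc k"]
  by (simp add: npc_condition_def minres_c_def minres_gamma1_def)

text \<open>
  The recurrence \<open>\<gamma>\<^sub>k\<^sub>+\<^sub>1\<^sup>(\<^sup>1\<^sup>) = - s\<^sub>k c\<^sub>k\<^sub>-\<^sub>1 \<beta>\<^sub>k\<^sub>+\<^sub>1 - c\<^sub>k \<alpha>\<^sub>k\<^sub>+\<^sub>1\<close>, divided by \<open>- c\<^sub>k\<close>, is the pivot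
  recurrence because \<open>s\<^sub>k / c\<^sub>k = \<beta>\<^sub>k\<^sub>+\<^sub>1 / \<gamma>\<^sub>k\<^sup>(\<^sup>1\<^sup>)\<close>. The positive pivots also keep \<open>c\<^sub>k\<close>, which is a
  nonzero multiple of \<open>c\<^sub>k\<^sub>-\<^sub>1 u\<^sub>k\<close>, away from zero, so that the division is legitimate.
\<close>

lemma minres_gamma1_eq_pivot:
  assumes "\<not> st_halted (minres A b k)"
    and "\<And>j. 1 \<le> j \<Longrightarrow> j \<le> k \<Longrightarrow> 0 < pivot (minres_alpha A b) (minres_beta A b) j"
  shows "minres_c A b k \<noteq> 0 \<and>
    minres_gamma1 A b (Suc k) =
      - minres_c A b k * pivot (minres_alpha A b) (minres_beta A b) (Suc k)"
  using assms
proof (induction k)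
  case 0
  have "\<not> st_halted (minres A b 0)" by (simp add: minres_def minres_init_def)
  note sc = minres_step_scalars[OF this, of A, folded minres_Suc]
  have "st_gamma1 (minres A b (Suc 0)) = st_alpha (minres A b (Suc 0))"
    by (simp only: sc(1)) (simp add: minres_def minres_init_def)
  then show ?case
    by (simp add: minres_c_def minres_gamma1_def minres_alpha_def)
       (simp add: minres_def minres_init_def)
next
  case (Suc k)
  define u where "u = pivot (minres_alpha A b) (minres_beta A b) (Suc k)"
  have u: "0 < u" using Suc.prems(2)[of "Suc k"] by (simp add: u_def)
  have running: "\<not> st_halted (minres A b k)"
    using Suc.prems(1) minres_halted_mono[of A b k "Suc k"] by auto
  let ?S = "minres A b (Suc k)" and ?S' = "minres A b (Suc (Suc k))"
  note sc = minres_step_scalars[OF running, of A, folded minres_Suc]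
  note sc' = minres_step_scalars[OF Suc.prems(1), of A, folded minres_Suc]
  define c where "c = st_c (minres A b k)"
  have c: "c \<noteq> 0" and g1: "st_gamma1 ?S = - c * u"
    using Suc.IH[OF running] Suc.prems(2)
    by (auto simp: c_def u_def minres_c_def minres_gamma1_def)
  have g2: "st_gamma2 ?S \<noteq> 0"
    using c u by (simp add: sc(3) g1 add_nonneg_eq_0_iff)
  have c': "st_c ?S = - c * u / st_gamma2 ?S"
    using sc(4)[OF g2] g1 by simp
  have "st_gamma1 ?S' =
      st_beta ?S / st_gamma2 ?S * (- c * st_beta ?S) - st_c ?S * st_alpha ?S'"
    using sc'(1) sc(2) sc(5)[OF g2] by (simp add: c_def)
  also have "\<dots> = - st_c ?S * (st_alpha ?S' - (st_beta ?S)\<^sup>2 / u)"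
    using u g2 by (simp add: c' field_simps power2_eq_square)
  finally have "st_gamma1 ?S' = - st_c ?S * (st_alpha ?S' - (st_beta ?S)\<^sup>2 / u)" .
  moreover have "st_c ?S \<noteq> 0"
    using c u g2 by (simp add: c')
  ultimately show ?case
    unfolding pivot.simps(2)[of _ _ "Suc k"] u_def[symmetric]
    by (simp add: minres_c_def minres_gamma1_def minres_alpha_def minres_beta_def)
qed

section \<open>Loss of definiteness and the NPC condition\<close>

lemma minres_T_eq_tridiag: "minres_T A b = tridiag (minres_alpha A b) (minres_beta A b)"
  by (intro ext) (simp add: minres_T_def tridiag_def)

lemma npc_condition_if_pivot_nonpos:
  assumes "\<And>j. 1 \<le> j \<Longrightarrow> j < k \<Longrightarrow> 0 < pivot (minres_alpha A b) (minres_beta A b) j"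
    and "1 \<le> k" and "pivot (minres_alpha A b) (minres_beta A b) k \<le> 0"
  shows "npc_condition A b k"
proof -
  obtain m where k: "k = Suc m" using assms(2) by (cases k) auto
  show ?thesis
  proof (cases "st_halted (minres A b m)")
    case True
    then show ?thesis using npc_condition_if_halted k by blast
  next
    case False
    have "minres_gamma1 A b k =
        - minres_c A b m * pivot (minres_alpha A b) (minres_beta A b) k"
      using minres_gamma1_eq_pivot[OF False] assms(1) unfolding k by simp
    then have "minres_c A b m * minres_gamma1 A b k =
        (minres_c A b m)\<^sup>2 * - pivot (minres_alpha A b) (minres_beta A b) k"
      by (simp add: power2_eq_square)
    then show ?thesis
      using assms(3) by (simp add: npc_condition_def k mult_nonneg_nonpos)
  qed
qed

lemma npc_condition_at_first_not_pos_def: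
  assumes "1 \<le> k" and "\<not> pos_def k (minres_T A b)"
    and pd: "\<And>j. 1 \<le> j \<Longrightarrow> j < k \<Longrightarrow> pos_def j (minres_T A b)"
  shows "npc_condition A b k"
proof -
  let ?u = "pivot (minres_alpha A b) (minres_beta A b)"
  have pos: "1 \<le> j \<longrightarrow> j < k \<longrightarrow> 0 < ?u j" for j
  proof (induction j rule: less_induct)
    case (less j)
    show ?case
    proof (intro impI)
      assume j: "1 \<le> j" "j < k"
      then show "0 < ?u j"
        using pos_def_tridiag_iff_pivot_pos[OF j(1), of "minres_alpha A b" "minres_beta A b"]
          less pd[OF j] by (auto simp: minres_T_eq_tridiag)
    qed
  qed
  then have "\<not> 0 < ?u k"
    using assms(2) pos_def_tridiag_iff_pivot_pos[OF assms(1), of "minres_alpha A b" "minres_beta A b"]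
    by (auto simp: minres_T_eq_tridiag)
  with pos assms(1) show ?thesis
    by (intro npc_condition_if_pivot_nonpos) auto
qed

theorem theorem1:
  fixes A :: "real^'n^'n" and b :: "real^'n" and g :: nat
  assumes "transpose A = A"
    and "b \<noteq> 0"
    and "is_grade A b g"
  shows "(\<forall>l. 1 \<le> l \<and> l \<le> g \<and> \<not> pos_def l (minres_T A b) \<longrightarrow>
            (\<exists>k. 1 \<le> k \<and> k \<le> l \<and> npc_condition A b k)) \<and>
         (\<forall>k. 1 \<le> k \<and> k \<le> g \<and> \<not> pos_def k (minres_T A b) \<and>
              (\<forall>j. 1 \<le> j \<and> j < k \<longrightarrow> pos_def j (minres_T A b)) \<longrightarrow>
            npc_condition A b k)"
proof (intro conjI allI impI)
  fix l assume l: "1 \<le> l \<and> l \<le> g \<and> \<not> pos_def l (minres_T A b)"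
  let ?P = "\<lambda>k. 1 \<le> k \<and> \<not> pos_def k (minres_T A b)"
  define k where "k = (LEAST k. ?P k)"
  have "?P k" and "k \<le> l"
    using l LeastI[of ?P l] Least_le[of ?P l] by (auto simp: k_def)
  moreover have "pos_def j (minres_T A b)" if "1 \<le> j" "j < k" for j
    using not_less_Least[of j ?P] that by (auto simp: k_def)
  ultimately have "npc_condition A b k"
    by (intro npc_condition_at_first_not_pos_def) auto
  with \<open>?P k\<close> \<open>k \<le> l\<close> show "\<exists>k. 1 \<le> k \<and> k \<le> l \<and> npc_condition A b k" by blast
next
  fix k assume "1 \<le> k \<and> k \<le> g \<and> \<not> pos_def k (minres_T A b) \<and>
      (\<forall>j. 1 \<le> j \<and> j < k \<longrightarrow> pos_def j (minres_T A b))"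
  then show "npc_condition A b k"
    by (intro npc_condition_at_first_not_pos_def) auto
qed

end
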